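(* For every integer $n\ge 1$, $$\sum_{k=0}^{n}\binom{2n+1}{2k}\left(2^{2k-1}-1\right)B_{2k}=0.$$
   Context: The Bernoulli numbers $B_m$ are defined by $\frac{x}{e^x-1}=\sum_{m=0}^\infty B_m\frac{x^m}{m!}$ for $|x|<2\pi$. For $k=0$ the factor $2^{2k-1}-1$ equals $-\tfrac12$. *)

theory Defs
  imports "HOL-Complex_Analysis.Complex_Analysis"
begin

text \<open>
  The point \<open>x = 0\<close> is a removable singularity of \<open>x / (exp x - 1)\<close> and must be excluded, since
  \<open>0 / 0 = 0\<close> in HOL.  That a unique such sequence exists is shown below, so the definite
  description is meaningful.
\<close>

definition bernoulli :: "nat \<Rightarrow> real" where
  "bernoulli = (THE B. \<forall>x::real. x \<noteq> 0 \<longrightarrow> \<bar>x\<bar> < 2 * pi \<longrightarrow>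
     (\<lambda>m. B m * (x ^ m / fact m)) sums (x / (exp x - 1)))"

lemma bernoulli_exists:
  "\<exists>B :: nat \<Rightarrow> real. \<forall>x::real. x \<noteq> 0 \<longrightarrow> \<bar>x\<bar> < 2 * pi \<longrightarrow>
     (\<lambda>m. B m * (x ^ m / fact m)) sums (x / (exp x - 1))"
proof -
  define S where "S = ball (0::complex) (2 * pi)"
  define g where "g = (\<lambda>z::complex. if z = 0 then 1 else (exp z - 1) / z)"
  define f where "f = (\<lambda>z::complex. 1 / g z)"
  have d: "deriv (\<lambda>z::complex. exp z - 1) 0 = 1"
    by (rule DERIV_imp_deriv) (auto intro!: derivative_eq_intros)
  have g: "g holomorphic_on S"
    by (rule pole_theorem_open_0[of "\<lambda>z. exp z - 1" S 0])
       (auto simp: g_def d S_def intro!: holomorphic_intros)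
  have nz: "g z \<noteq> 0" if "z \<in> S" for z
  proof (cases "z = 0")
    case False
    have "exp z \<noteq> 1"
    proof
      assume "exp z = 1"
      then obtain n :: int where n: "Re z = 0" "Im z = of_int (2 * n) * pi"
        by (auto simp: exp_eq_1)
      have "n \<noteq> 0" using n False by (auto simp: complex_eq_iff)
      hence "1 \<le> \<bar>real_of_int n\<bar>" by linarith
      hence "2 * pi \<le> \<bar>Im z\<bar>" by (simp add: n abs_mult)
      also have "\<dots> \<le> norm z" by (rule abs_Im_le_cmod)
      finally show False using that by (simp add: S_def)
    qed
    with False show ?thesis by (simp add: g_def)
  qed (simp add: g_def)
  have f: "f holomorphic_on ball 0 (2 * pi)"
    unfolding f_def using g nz by (auto intro!: holomorphic_intros simp: S_def)
  define B where "B = (\<lambda>m. Re ((deriv ^^ m) f 0))"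
  have "(\<lambda>m. B m * (x ^ m / fact m)) sums (x / (exp x - 1))"
    if x: "x \<noteq> 0" "\<bar>x\<bar> < 2 * pi" for x :: real
  proof -
    have "(\<lambda>m. (deriv ^^ m) f 0 / fact m * (of_real x - 0) ^ m) sums f (of_real x)"
      by (rule holomorphic_power_series[OF f]) (use x in auto)
    hence "(\<lambda>m. Re ((deriv ^^ m) f 0 / fact m * (of_real x - 0) ^ m)) sums Re (f (of_real x))"
      by (rule sums_Re)
    moreover have "Re ((deriv ^^ m) f 0 / fact m * (of_real x - 0) ^ m) = B m * (x ^ m / fact m)" for m
    proof -
      have "(deriv ^^ m) f 0 / fact m * (of_real x - 0) ^ m
              = of_real (x ^ m / fact m) * (deriv ^^ m) f 0"
        by simp
      thus ?thesis by (simp only: Re_complex_of_real Im_complex_of_real times_complex.sel B_def) simp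
    qed
    moreover have "f (of_real x) = of_real (x / (exp x - 1))"
      using x by (simp add: f_def g_def exp_of_real)
    ultimately show ?thesis by simp
  qed
  thus ?thesis by blast
qed

lemma bernoulli_unique:
  fixes B C :: "nat \<Rightarrow> real"
  assumes B: "\<forall>x::real. x \<noteq> 0 \<longrightarrow> \<bar>x\<bar> < 2 * pi \<longrightarrow>
                (\<lambda>m. B m * (x ^ m / fact m)) sums (x / (exp x - 1))"
    and C: "\<forall>x::real. x \<noteq> 0 \<longrightarrow> \<bar>x\<bar> < 2 * pi \<longrightarrow>
                (\<lambda>m. C m * (x ^ m / fact m)) sums (x / (exp x - 1))"
  shows "B = C"
proof -
  define d where "d = (\<lambda>m. (B m - C m) / fact m)"
  have d: "(\<lambda>m. d m * x ^ m) sums 0" if "x \<noteq> 0" "\<bar>x\<bar> < 2 * pi" for x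
    using sums_diff[OF B[rule_format, OF that] C[rule_format, OF that]]
    by (simp add: d_def diff_divide_distrib left_diff_distrib)
  have "((\<lambda>_. 0) \<longlongrightarrow> d 0) (at (0::real))"
    by (rule powser_limit_0_strong[of "2 * pi"]) (use d in auto)
  hence d0: "d 0 = 0" using LIM_unique tendsto_const by blast
  have "d m = 0" for m
  proof (rule ccontr)
    assume m: "d m \<noteq> 0"
    hence "m > 0" using d0 by (cases m) auto
    have *: "(\<lambda>m. d m * (x - 0) ^ m) sums 0" if "norm (x - 0) < 2 * pi" for x
      using that d[of x] d0 by (cases "x = 0") auto
    obtain s where s: "0 < s" "\<And>z::real. z \<in> cball 0 s - {0} \<Longrightarrow> (0::real) \<noteq> 0"
      using powser_0_nonzero[of "2 * pi" 0 d "\<lambda>_. 0" m, OF _ * refl m \<open>m > 0\<close>] pi_gt_zero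
      by (metis mult_pos_pos zero_less_numeral)
    from s(2)[of s] s(1) show False by simp
  qed
  thus ?thesis by (auto simp: d_def fun_eq_iff)
qed

lemma bernoulli_sums:
  fixes x :: real
  assumes "x \<noteq> 0" "\<bar>x\<bar> < 2 * pi"
  shows "(\<lambda>m. bernoulli m * (x ^ m / fact m)) sums (x / (exp x - 1))"
proof -
  have "\<exists>!B. \<forall>x::real. x \<noteq> 0 \<longrightarrow> \<bar>x\<bar> < 2 * pi \<longrightarrow>
          (\<lambda>m. B m * (x ^ m / fact m)) sums (x / (exp x - 1))"
    using bernoulli_exists bernoulli_unique by blast
  from theI'[OF this] show ?thesis
    using assms unfolding bernoulli_def by blast
qed

end

theory Submission
  imports Defs
begin

text \<open>
  Put \<open>c j = (2\<^sup>j / 2 - 1) * B j\<close>. Since \<open>2\<^sup>j * B j\<close> are the coefficients of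
  \<open>2 * x / (exp (2 * x) - 1)\<close>, the numbers \<open>c j\<close> have the exponential generating function
  \<open>x / (exp (2 * x) - 1) - x / (exp x - 1) = - x / (exp x - exp (- x))\<close>
  (\<open>halved_bernoulli_sums\<close>). Multiplying by \<open>exp x - exp (- x)\<close>, a series in odd powers only,
  gives the polynomial \<open>- x\<close> (\<open>halved_bernoulli_times_sinh\<close>), so the coefficient of degree
  \<open>2 * n + 1\<close> in the product is zero for \<open>n \<ge> 1\<close>. In the convolution that computes this
  coefficient, the total degree is odd and the second factor contributes odd degrees only,
  which leaves precisely the \<open>c j\<close> with \<open>j\<close> even; up to the factor \<open>2 / fact (2 * n + 1)\<close>
  the coefficient is the sum in the theorem.
\<close>

definition halved_bernoulli_fps :: "real fps" where
  "halved_bernoulli_fps = Abs_fps (\<lambda>j. (2 ^ j / 2 - 1) * bernoulli j / fact j)"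

text \<open>
  With \<open>y = exp x\<close> the closed form rests on
  \<open>1 / (y\<^sup>2 - 1) - 1 / (y - 1) = - y / (y\<^sup>2 - 1)\<close>.
  The radius of validity drops from \<open>2 * pi\<close> to \<open>pi\<close> because the defining series is
  evaluated at both \<open>x\<close> and \<open>2 * x\<close>.
\<close>

lemma halved_bernoulli_sums:
  fixes x :: real
  assumes "x \<noteq> 0" "\<bar>x\<bar> < pi"
  shows "(\<lambda>j. fps_nth halved_bernoulli_fps j * x ^ j) sums (- x / (exp x - exp (- x)))"
proof -
  have "(\<lambda>j. 1/2 * (bernoulli j * ((2 * x) ^ j / fact j)) - bernoulli j * (x ^ j / fact j))
          sums (1/2 * (2 * x / (exp (2 * x) - 1)) - x / (exp x - 1))"
    using assms by (intro sums_diff sums_mult bernoulli_sums) (auto simp: abs_mult)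
  moreover have "1/2 * (2 * x / (exp (2 * x) - 1)) - x / (exp x - 1) = - x / (exp x - exp (- x))"
  proof -
    define y where "y = exp x"
    have y: "y > 0" "y \<noteq> 1" "y * y \<noteq> 1"
      using assms by (auto simp: y_def simp flip: exp_add)
    have "x / (y * y - 1) - x / (y - 1) = - x / (y - 1 / y)"
    proof -
      have "y * y - 1 = (y - 1) * (y + 1)" "y - 1 / y = (y - 1) * (y + 1) / y"
        using y by (simp_all add: field_simps)
      thus ?thesis using y by (simp add: divide_simps) (simp add: algebra_simps)
    qed
    moreover have "exp (2 * x) = y * y" "exp (- x) = 1 / y"
      by (simp_all add: y_def exp_minus field_simps flip: exp_add)
    ultimately show ?thesis by (simp add: y_def)
  qed
  moreover have "1/2 * (bernoulli j * ((2 * x) ^ j / fact j)) - bernoulli j * (x ^ j / fact j)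
                   = fps_nth halved_bernoulli_fps j * x ^ j" for j
    by (simp add: halved_bernoulli_fps_def power_mult_distrib field_simps)
  ultimately show ?thesis by (simp only:)
qed

lemma conv_radius_halved_bernoulli: "fps_conv_radius halved_bernoulli_fps \<ge> 1"
proof -
  have "summable (\<lambda>j. fps_nth halved_bernoulli_fps j * 1 ^ j)"
    using halved_bernoulli_sums[of 1] pi_gt3 by (intro sums_summable) auto
  from conv_radius_geI[OF this] show ?thesis
    by (simp add: fps_conv_radius_def one_ereal_def)
qed

text \<open>
  A nonzero power series has only isolated zeros, so it cannot vanish on an interval
  around the origin.
\<close>

lemma real_fps_eqI:
  fixes f g :: "real fps"
  assumes r: "r > 0" "ereal r \<le> fps_conv_radius f" "ereal r \<le> fps_conv_radius g"
    and eq: "\<And>x. \<bar>x\<bar> < r \<Longrightarrow> eval_fps f x = eval_fps g x"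
  shows "f = g"
proof (rule ccontr)
  define h where "h = f - g"
  have h: "(\<lambda>n. fps_nth h n * (x - 0) ^ n) sums 0" if x: "norm (x - 0) < r" for x
  proof -
    have xr: "ereal (norm x) < fps_conv_radius f" "ereal (norm x) < fps_conv_radius g"
      using x r by (auto intro: less_le_trans[of _ "ereal r"])
    have "(\<lambda>n. fps_nth f n * x ^ n - fps_nth g n * x ^ n) sums (eval_fps f x - eval_fps g x)"
      by (intro sums_diff sums_eval_fps xr)
    thus ?thesis using eq[of x] x by (simp add: h_def left_diff_distrib)
  qed
  assume "f \<noteq> g"
  then obtain m where m: "fps_nth h m \<noteq> 0"
    by (auto simp: h_def fps_eq_iff)
  have "fps_nth h 0 = 0"
    using h[of 0] r by (simp add: powser_sums_zero_iff)
  with m have "m > 0" by (cases m) auto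
  obtain s where s: "0 < s" "\<And>z::real. z \<in> cball 0 s - {0} \<Longrightarrow> (0::real) \<noteq> 0"
    using powser_0_nonzero[of r 0 "fps_nth h" "\<lambda>_. 0" m] h r m \<open>m > 0\<close> by metis
  from s(2)[of s] s(1) show False by simp
qed

text \<open>
  As an identity of formal series this also covers the point \<open>0\<close>, where the quotient
  defining the generating function degenerates: there the factor \<open>exp x - exp (- x)\<close> vanishes.
\<close>

lemma halved_bernoulli_times_sinh:
  "halved_bernoulli_fps * (fps_exp 1 - fps_exp (- 1)) = - fps_X"
    (is "?A * ?S = _")
proof (rule real_fps_eqI[of 1])
  have S: "fps_conv_radius ?S = \<infinity>"
    using fps_conv_radius_diff[of "fps_exp (1::real)" "fps_exp (- 1)"] by simp
  show "ereal 1 \<le> fps_conv_radius (?A * ?S)"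
    using fps_conv_radius_mult[of ?A ?S] S conv_radius_halved_bernoulli
    by (simp add: one_ereal_def)
  show "eval_fps (?A * ?S) x = eval_fps (- fps_X) x" if x: "\<bar>x\<bar> < 1" for x :: real
  proof -
    have xA: "ereal (norm x) < fps_conv_radius ?A"
      using x by (intro less_le_trans[OF _ conv_radius_halved_bernoulli])
                 (simp add: one_ereal_def)
    have "eval_fps (?A * ?S) x = eval_fps ?A x * (exp x - exp (- x))"
      using xA S by (simp add: eval_fps_mult eval_fps_diff)
    also have "\<dots> = - x"
    proof (cases "x = 0")
      case False
      hence "eval_fps ?A x = - x / (exp x - exp (- x))"
        using halved_bernoulli_sums[of x] x pi_gt3 by (simp add: eval_fps_def sums_iff)
      moreover have "exp x - exp (- x) \<noteq> 0" using False by simp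
      ultimately show ?thesis by simp
    qed simp
    finally show ?thesis by (simp add: eval_fps_minus)
  qed
qed simp_all

theorem theorem4:
  fixes n :: nat
  assumes "n \<ge> 1"
  shows "(\<Sum>k = 0..n. real ((2 * n + 1) choose (2 * k)) *
           (2 powi (2 * int k - 1) - 1) * bernoulli (2 * k)) = 0"
proof -
  let ?N = "2 * n + 1"
  let ?A = "fps_nth halved_bernoulli_fps"
  let ?t = "\<lambda>j. ?A j * ((1 - (- 1) ^ (?N - j)) / fact (?N - j))"
  have "0 = fps_nth (halved_bernoulli_fps * (fps_exp 1 - fps_exp (- 1))) ?N"
    using assms by (simp add: halved_bernoulli_times_sinh)
  also have "\<dots> = (\<Sum>j = 0..?N. ?t j)"
    by (simp add: fps_mult_nth diff_divide_distrib)
  \<comment> \<open>The second factor has coefficient \<open>2 / fact m\<close> in odd degree \<open>m\<close> and \<open>0\<close> in even degree.\<close>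
  also have "{0..?N} = {..<2 * (n + 1)}" by auto
  also have "(\<Sum>j<2 * (n + 1). ?t j)
               = (\<Sum>j<2 * (n + 1). if even j then ?A j * (2 / fact (?N - j)) else 0)"
    by (intro sum.cong refl) (auto simp: minus_one_power_iff)
  also have "\<dots> = (\<Sum>k = 0..n. ?A (2 * k) * (2 / fact (?N - 2 * k)))"
    unfolding sum_split_even_odd by (simp only: Suc_eq_plus1 [symmetric]
      lessThan_Suc_atMost atLeast0AtMost even_mult_iff) simp
  also have "\<dots> = (\<Sum>k = 0..n. 2 / fact ?N * (real (?N choose (2 * k)) *
               (2 powi (2 * int k - 1) - 1) * bernoulli (2 * k)))"
  proof (intro sum.cong refl)
    fix k assume "k \<in> {0..n}"
    hence "real (?N choose (2 * k)) = fact ?N / (fact (2 * k) * fact (?N - 2 * k))"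
      by (intro binomial_fact) auto
    moreover have "(2::real) powi (2 * int k - 1) = 2 ^ (2 * k) / 2"
      using power_int_of_nat[of "2::real" "2 * k"] by (simp add: power_int_diff)
    ultimately show "?A (2 * k) * (2 / fact (?N - 2 * k)) = 2 / fact ?N *
        (real (?N choose (2 * k)) * (2 powi (2 * int k - 1) - 1) * bernoulli (2 * k))"
      by (simp add: halved_bernoulli_fps_def del: fact_Suc)
  qed
  finally show ?thesis
    unfolding sum_distrib_left [symmetric] by (simp del: fact_Suc)
qed

end
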